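(* Let $\gamma\colon[a,b]\to\mathbf{R}^3$ be a rectifiable curve with length $L$ and width $w$. Then $$L\geq 3.7669\,w.$$ Furthermore, if $\gamma$ is closed (i.e. $\gamma(a)=\gamma(b)$), then $$L\geq \sqrt{\pi^2+16}\;w \;(>5.0862\,w).$$
   Context: A curve is a continuous map $\gamma\colon[a,b]\to\mathbf{R}^3$; its length $L$ is the supremum of $\sum_{i}\|\gamma(t_i)-\gamma(t_{i-1})\|$ over all partitions $a=t_0\le t_1\le\dots\le t_k=b$, and $\gamma$ is rectifiable if $L<\infty$. The width $w$ of $\gamma$ is the infimum of the distances between all pairs of parallel planes such that $\gamma([a,b])$ lies in the closed slab between them. *)

theory Defs
  imports "HOL-Analysis.Analysis"
begin

definition is_partition :: "real \<Rightarrow> real \<Rightarrow> real list \<Rightarrow> bool" where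
  "is_partition a b ts \<longleftrightarrow> ts \<noteq> [] \<and> hd ts = a \<and> last ts = b \<and> sorted ts"

definition poly_length :: "(real \<Rightarrow> 'a::real_normed_vector) \<Rightarrow> real list \<Rightarrow> real" where
  "poly_length \<gamma> ts = (\<Sum>i<length ts - 1. norm (\<gamma> (ts ! Suc i) - \<gamma> (ts ! i)))"

definition curve_length :: "(real \<Rightarrow> 'a::real_normed_vector) \<Rightarrow> real \<Rightarrow> real \<Rightarrow> ereal" where
  "curve_length \<gamma> a b = (SUP ts \<in> {ts. is_partition a b ts}. ereal (poly_length \<gamma> ts))"

definition rectifiable_curve :: "(real \<Rightarrow> 'a::real_normed_vector) \<Rightarrow> real \<Rightarrow> real \<Rightarrow> bool" where
  "rectifiable_curve \<gamma> a b \<longleftrightarrow> curve_length \<gamma> a b < \<infinity>"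

definition curve_width :: "(real \<Rightarrow> real^3) \<Rightarrow> real \<Rightarrow> real \<Rightarrow> real" where
  "curve_width \<gamma> a b = Inf {d - c | u c d. norm u = 1 \<and> c \<le> d \<and>
      (\<forall>t\<in>{a..b}. c \<le> u \<bullet> \<gamma> t \<and> u \<bullet> \<gamma> t \<le> d)}"

end

theory Submission
  imports Defs
begin

text \<open>
  For a fine inscribed polygon there is, by a Borsuk--Ulam argument going back to Wienholtz, a
  direction \<open>u\<close> in which the polygon runs alternately between its two extreme supporting planes
  four times; so its variation along \<open>u\<close> is at least three times the width, and four times if
  it is closed. The projection to the plane orthogonal to \<open>u\<close> again has at least that width, and
  its length is bounded below by a weighted Crofton formula: in coordinates whose first axis is
  parallel to the chord between the endpoints, for \<open>0 \<le> c \<le> d \<le> pi / 2\<close>,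
  \<open>norm (x, y) \<ge> sin c * \<bar>y\<bar> + cos d * \<bar>x\<bar> + integral {c..d} (\<lambda>s. max (\<bar>x\<bar> * sin s) (\<bar>y\<bar> * cos s))\<close>.
  Summed over the edges, this bounds the planar length by \<open>2 * W * (sin c + d - c)\<close> plus the
  chord length times \<open>2 * cos d - cos c\<close>. The chord term vanishes for closed curves, where
  \<open>c = 0\<close>, \<open>d = pi / 2\<close> is optimal, and it is harmless for open ones as soon as
  \<open>2 * cos d = cos c\<close>. Finally the length of a space polygon is at least the hypotenuse of its
  variation along \<open>u\<close> and the length of its projection.
\<close>

section \<open>Borsuk--Ulam for maps from the two-sphere to the plane\<close>

text \<open>If \<open>f x - f (- x)\<close> had no zero, it would have a continuous logarithm
  \<open>g\<close> on the simply connected sphere. Since the difference is odd,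
  \<open>exp (g (- x) - g x) = - 1\<close> everywhere. But the imaginary part of
  \<open>g (- x) - g x\<close> is odd and continuous on a connected set, so it vanishes somewhere,
  and there the exponential is positive.\<close>

lemma Borsuk_Ulam_sphere_2:
  fixes f :: "real^3 \<Rightarrow> complex"
  assumes "continuous_on (sphere 0 1) f"
  obtains u where "norm u = 1" "f u = f (- u)"
proof (rule ccontr)
  let ?S = "sphere (0::real^3) 1"
  assume "\<not> thesis"
  then have ne: "f x - f (- x) \<noteq> 0" if "x \<in> ?S" for x
    using that \<open>\<And>u. norm u = 1 \<Longrightarrow> f u = f (- u) \<Longrightarrow> thesis\<close> by auto
  have neg: "continuous_on ?S (\<lambda>x. g (- x))" if "continuous_on ?S g" for g :: "real^3 \<Rightarrow> complex"
    by (rule continuous_on_compose2[OF that]) (auto intro!: continuous_intros)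
  obtain g where g: "continuous_on ?S g" "\<And>x. x \<in> ?S \<Longrightarrow> f x - f (- x) = exp (g x)"
  proof (rule continuous_logarithm_on_simply_connected[of ?S "\<lambda>x. f x - f (- x)"])
    show "continuous_on ?S (\<lambda>x. f x - f (- x))"
      by (intro continuous_on_diff assms neg)
    show "simply_connected ?S" by (rule simply_connected_sphere) simp
    show "locally path_connected ?S" by (rule locally_path_connected_sphere)
  qed (use ne in auto)
  define d where "d x = Im (g (- x) - g x)" for x
  have d_odd: "d (- x) = - d x" for x by (simp add: d_def)
  have "continuous_on ?S d"
    unfolding d_def by (intro continuous_on_Im continuous_on_diff g neg)
  moreover have "connected ?S" by (rule connected_sphere) simp
  ultimately have conn: "connected (d ` ?S)" by (rule connected_continuous_image)
  have e: "axis 1 1 \<in> ?S" "- axis 1 1 \<in> ?S" by auto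
  have "min (d (axis 1 1)) (d (- axis 1 1)) \<in> d ` ?S" "max (d (axis 1 1)) (d (- axis 1 1)) \<in> d ` ?S"
    using e by (auto simp: min_def max_def)
  then have "0 \<in> d ` ?S"
    by (rule connectedD_interval[OF conn]) (auto simp: d_odd)
  then obtain x where x: "x \<in> ?S" "d x = 0" by auto
  then have "- x \<in> ?S" by simp
  then have "exp (g (- x)) = - exp (g x)"
    using g(2)[of x] g(2)[of "- x"] x(1) by (metis minus_diff_eq minus_minus)
  then have "exp (g (- x) - g x) = - 1"
    by (simp add: exp_diff)
  moreover have "g (- x) - g x = of_real (Re (g (- x) - g x))"
    using x by (simp add: complex_eq_iff d_def)
  ultimately have "of_real (exp (Re (g (- x) - g x))) = (- 1 :: complex)"
    by (metis exp_of_real)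
  then have "exp (Re (g (- x) - g x)) = - 1"
    by (metis of_real_1 of_real_eq_iff of_real_minus)
  then show False by (metis exp_gt_zero less_minus_one_simps(1) order.asym)
qed

section \<open>Interlacing of finite sets with equal moments\<close>

text \<open>The measure with weights \<open>p\<close> on \<open>A\<close> and \<open>- q\<close> on
  \<open>B\<close> annihilates polynomials of degree at most two. With fewer than three sign
  changes, a polynomial with its roots at the changes would have a nonzero integral.\<close>

lemma alternation_of_equal_moments_aux:
  fixes A B :: "real set" and p q :: "real \<Rightarrow> real"
  assumes fin: "finite A" "finite B" and ne: "A \<noteq> {}" "B \<noteq> {}"
    and pos: "\<And>t. t \<in> A \<Longrightarrow> 0 < p t" "\<And>t. t \<in> B \<Longrightarrow> 0 < q t"
    and m0: "(\<Sum>t\<in>A. p t) = (\<Sum>t\<in>B. q t)"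
    and m1: "(\<Sum>t\<in>A. p t * t) = (\<Sum>t\<in>B. q t * t)"
    and m2: "(\<Sum>t\<in>A. p t * t\<^sup>2) = (\<Sum>t\<in>B. q t * t\<^sup>2)"
    and lt: "Min A < Min B"
  obtains t0 t1 t2 t3 where "t0 < t1" "t1 < t2" "t2 < t3" "t0 \<in> A" "t1 \<in> B" "t2 \<in> A" "t3 \<in> B"
proof -
  have quad: "(\<Sum>t\<in>A. p t * (t\<^sup>2 + c * t + d)) = (\<Sum>t\<in>B. q t * (t\<^sup>2 + c * t + d))" for c d
  proof -
    have "(\<Sum>t\<in>A. p t * (t\<^sup>2 + c * t + d)) = (\<Sum>t\<in>A. p t * t\<^sup>2) + c * (\<Sum>t\<in>A. p t * t) + d * (\<Sum>t\<in>A. p t)"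
      by (simp add: sum_distrib_left sum.distrib[symmetric] algebra_simps)
    also have "\<dots> = (\<Sum>t\<in>B. q t * (t\<^sup>2 + c * t + d))"
      unfolding m0 m1 m2
      by (simp add: sum_distrib_left sum.distrib[symmetric] algebra_simps)
    finally show ?thesis .
  qed
  define a b where "a = Min A" and "b = Min B"
  have aA: "a \<in> A" and bB: "b \<in> B" and bmin: "\<And>t. t \<in> B \<Longrightarrow> b \<le> t"
    using fin ne by (auto simp: a_def b_def)
  define A' where "A' = {t \<in> A. b < t}"
  \<comment> \<open>Otherwise \<open>t - b\<close> is nonpositive on \<open>A\<close>, strictly so
    at \<open>a\<close>, and nonnegative on \<open>B\<close>, against the equality of the zeroth and
    first moments.\<close>
  have "A' \<noteq> {}"
  proof
    assume "A' = {}"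
    then have "p t * (t - b) \<le> 0" if "t \<in> A" for t
      using that pos(1)[OF that] by (auto simp: A'_def mult_le_0_iff)
    moreover have "p a * (a - b) < 0"
      using pos(1)[OF aA] lt by (simp add: a_def b_def mult_less_0_iff)
    ultimately have "(\<Sum>t\<in>A. p t * (t - b)) < (\<Sum>t\<in>A. 0)"
      using fin aA by (intro sum_strict_mono_ex1) auto
    moreover have "0 \<le> (\<Sum>t\<in>B. q t * (t - b))"
      using pos(2) bmin by (intro sum_nonneg mult_nonneg_nonneg) (auto intro: less_imp_le)
    moreover have "(\<Sum>t\<in>A. p t * (t - b)) = (\<Sum>t\<in>A. p t * t) - b * (\<Sum>t\<in>A. p t)"
      by (simp add: sum_distrib_left sum_subtractf[symmetric] algebra_simps)
    moreover have "(\<Sum>t\<in>B. q t * (t - b)) = (\<Sum>t\<in>B. q t * t) - b * (\<Sum>t\<in>B. q t)"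
      by (simp add: sum_distrib_left sum_subtractf[symmetric] algebra_simps)
    ultimately show False using m0 m1 by simp
  qed
  define c where "c = Min A'"
  have c: "c \<in> A" "b < c" "\<And>t. t \<in> A \<Longrightarrow> b < t \<Longrightarrow> c \<le> t"
  proof -
    have "finite A'" using fin by (simp add: A'_def)
    then have "c \<in> A'" "\<And>t. t \<in> A' \<Longrightarrow> c \<le> t" using \<open>A' \<noteq> {}\<close> by (auto simp: c_def)
    then show "c \<in> A" "b < c" "\<And>t. t \<in> A \<Longrightarrow> b < t \<Longrightarrow> c \<le> t" by (auto simp: A'_def)
  qed
  show thesis
  proof (cases "\<exists>d\<in>B. c < d")
    case True
    then obtain d where "d \<in> B" "c < d" by auto
    then show thesis using that[of a b c d] aA bB c lt by (auto simp: a_def b_def)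
  next
    case False
    \<comment> \<open>Otherwise \<open>(t - b) * (t - c)\<close> separates \<open>A\<close> from \<open>B\<close>.\<close>
    have eq: "t\<^sup>2 + (- b - c) * t + b * c = (t - b) * (t - c)" for t :: real
      by (simp add: power2_eq_square algebra_simps)
    have "0 \<le> p t * ((t - b) * (t - c))" if "t \<in> A" for t
    proof -
      have "0 \<le> (t - b) * (t - c)"
        using c(2) c(3)[OF that] by (cases "b < t") (auto simp: zero_le_mult_iff)
      then show ?thesis using pos(1)[OF that] by simp
    qed
    moreover have "0 < p a * ((a - b) * (a - c))"
      using pos(1)[OF aA] lt c by (auto simp: a_def b_def zero_less_mult_iff)
    ultimately have "(\<Sum>t\<in>A. 0) < (\<Sum>t\<in>A. p t * ((t - b) * (t - c)))"
      using fin aA by (intro sum_strict_mono_ex1) auto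
    moreover have "(\<Sum>t\<in>B. q t * ((t - b) * (t - c))) \<le> 0"
    proof (rule sum_nonpos)
      fix t assume t: "t \<in> B"
      then have "(t - b) * (t - c) \<le> 0"
        using bmin[OF t] False by (auto simp: mult_le_0_iff not_less)
      then show "q t * ((t - b) * (t - c)) \<le> 0" using pos(2)[OF t] by (simp add: mult_le_0_iff)
    qed
    ultimately show thesis using quad[of "- b - c" "b * c"] unfolding eq by simp
  qed
qed

lemma alternation_of_equal_moments:
  fixes A B :: "real set" and p q :: "real \<Rightarrow> real"
  assumes fin: "finite A" "finite B" and ne: "A \<noteq> {}" "B \<noteq> {}" and dis: "A \<inter> B = {}"
    and pos: "\<And>t. t \<in> A \<Longrightarrow> 0 < p t" "\<And>t. t \<in> B \<Longrightarrow> 0 < q t"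
    and m0: "(\<Sum>t\<in>A. p t) = (\<Sum>t\<in>B. q t)"
    and m1: "(\<Sum>t\<in>A. p t * t) = (\<Sum>t\<in>B. q t * t)"
    and m2: "(\<Sum>t\<in>A. p t * t\<^sup>2) = (\<Sum>t\<in>B. q t * t\<^sup>2)"
  obtains t0 t1 t2 t3 where "t0 < t1" "t1 < t2" "t2 < t3"
    "t0 \<in> A \<and> t1 \<in> B \<and> t2 \<in> A \<and> t3 \<in> B \<or> t0 \<in> B \<and> t1 \<in> A \<and> t2 \<in> B \<and> t3 \<in> A"
proof -
  have "Min A \<noteq> Min B" using fin ne dis by (metis Min_in disjoint_iff)
  then consider "Min A < Min B" | "Min B < Min A" by linarith
  then show thesis
  proof cases
    case 1
    then show thesis
      using alternation_of_equal_moments_aux[OF fin ne pos m0 m1 m2] that by metis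
  next
    case 2
    then show thesis
      using alternation_of_equal_moments_aux[OF fin(2,1) ne(2,1) pos(2,1) m0[symmetric]
          m1[symmetric] m2[symmetric]] that by metis
  qed
qed

section \<open>A direction with four alternating extremes\<close>

lemma continuous_on_Max_image:
  fixes f :: "'i \<Rightarrow> 'a::topological_space \<Rightarrow> 'b::linorder_topology"
  assumes "finite I" "I \<noteq> {}" "\<And>i. i \<in> I \<Longrightarrow> continuous_on S (f i)"
  shows "continuous_on S (\<lambda>x. Max ((\<lambda>i. f i x) ` I))"
  using assms
proof (induction I rule: finite_ne_induct)
  case (insert i I)
  then have "(\<lambda>x. Max ((\<lambda>i. f i x) ` insert i I)) = (\<lambda>x. max (f i x) (Max ((\<lambda>i. f i x) ` I)))"
    by (auto simp: fun_eq_iff)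
  then show ?case using insert by (auto intro!: continuous_on_max)
qed auto

text \<open>
  Weight the vertices close to the maximum of \<open>u \<bullet> p i\<close> and form the barycenter of the points
  \<open>(i, i\<^sup>2)\<close>. By Borsuk--Ulam it agrees for some \<open>u\<close> and \<open>- u\<close>, so the near-maximal and the
  near-minimal indices have equal moments up to order two and therefore interlace.
\<close>

lemma Wienholtz_alternation:
  fixes p :: "nat \<Rightarrow> real^3"
  assumes width: "\<And>u. norm u = 1 \<Longrightarrow> \<exists>i\<le>n. \<exists>j\<le>n. W \<le> u \<bullet> p i - u \<bullet> p j"
    and \<delta>: "0 < \<delta>" "\<delta> < W"
  obtains u i0 i1 i2 i3 where "norm u = 1" "i0 < i1" "i1 < i2" "i2 < i3" "i3 \<le> n"
    "\<delta> \<le> \<bar>u \<bullet> p i1 - u \<bullet> p i0\<bar>" "\<delta> \<le> \<bar>u \<bullet> p i2 - u \<bullet> p i1\<bar>"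
    "\<delta> \<le> \<bar>u \<bullet> p i3 - u \<bullet> p i2\<bar>" "\<delta> \<le> \<bar>u \<bullet> p i0 - u \<bullet> p i3\<bar>"
proof -
  \<comment> \<open>Half the slack: heights within \<open>\<epsilon>\<close> of the maximum and of
    the minimum along \<open>u\<close> still differ by at least
    \<open>W - 2 * \<epsilon> = \<delta>\<close>.\<close>
  define \<epsilon> where "\<epsilon> = (W - \<delta>) / 2"
  have \<epsilon>: "0 < \<epsilon>" using \<delta> by (simp add: \<epsilon>_def)
  define M where "M u = Max ((\<lambda>i. u \<bullet> p i) ` {..n})" for u
  define w where "w u i = max 0 (u \<bullet> p i - M u + \<epsilon>)" for u i
  have M_ge: "u \<bullet> p i \<le> M u" if "i \<le> n" for u i
    using that by (auto simp: M_def)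
  have w0: "0 \<le> w u i" for u i by (simp add: w_def)
  have cont_M: "continuous_on S M" for S
    unfolding M_def by (rule continuous_on_Max_image) (auto intro!: continuous_intros)
  then have cont_w: "continuous_on S (\<lambda>u. w u i)" for S i
    unfolding w_def by (intro continuous_intros)
  define T where "T u = (\<Sum>i\<le>n. w u i)" for u
  have ex_pos: "\<exists>i\<le>n. 0 < w u i" for u
  proof -
    have "M u \<in> (\<lambda>i. u \<bullet> p i) ` {..n}" unfolding M_def by (rule Max_in) auto
    then obtain i where "i \<le> n" "M u = u \<bullet> p i" by auto
    then have "0 < w u i" using \<epsilon> by (simp add: w_def)
    then show ?thesis using \<open>i \<le> n\<close> by auto
  qed
  have T: "0 < T u" for u
  proof -
    obtain i where i: "i \<le> n" "0 < w u i" using ex_pos by auto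
    then have "w u i \<le> T u" unfolding T_def by (intro member_le_sum) (auto simp: w0)
    then show ?thesis using i by linarith
  qed
  define c1 where "c1 u = (\<Sum>i\<le>n. w u i * real i) / T u" for u
  define c2 where "c2 u = (\<Sum>i\<le>n. w u i * (real i)\<^sup>2) / T u" for u
  have "T u \<noteq> 0" for u using T[of u] by simp
  then have "continuous_on (sphere 0 1) (\<lambda>u. Complex (c1 u) (c2 u))"
    unfolding c1_def c2_def T_def by (intro continuous_intros cont_w) auto
  then obtain u where u: "norm u = 1" "Complex (c1 u) (c2 u) = Complex (c1 (- u)) (c2 (- u))"
    using Borsuk_Ulam_sphere_2 by blast
  then have c: "c1 u = c1 (- u)" "c2 u = c2 (- u)" by auto
  define A where "A v = {t. \<exists>i\<le>n. t = real i \<and> 0 < w v i}" for v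
  have finA: "finite (A v)" for v
  proof (rule finite_subset)
    show "A v \<subseteq> real ` {..n}" by (auto simp: A_def)
  qed simp
  have neA: "A v \<noteq> {}" for v using ex_pos[of v] by (auto simp: A_def)
  obtain a b where ab: "a \<le> n" "b \<le> n" "W \<le> u \<bullet> p a - u \<bullet> p b" using width[OF u(1)] by auto
  \<comment> \<open>\<open>- M (- u)\<close> is the minimum of \<open>u \<bullet> p i\<close>, so
    the sum is the extent of the polygon along \<open>u\<close>.\<close>
  have MM: "W \<le> M u + M (- u)"
    using ab M_ge[OF ab(1), of u] M_ge[OF ab(2), of "- u"] by simp
  have alt: "\<delta> \<le> u \<bullet> p i - u \<bullet> p j" if "real i \<in> A u" "real j \<in> A (- u)" for i j
  proof -
    have "M u - \<epsilon> < u \<bullet> p i" "M (- u) - \<epsilon> < - (u \<bullet> p j)"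
      using that by (auto simp: A_def w_def less_max_iff_disj)
    then show ?thesis using MM by (simp add: \<epsilon>_def field_simps)
  qed
  have "A u \<inter> A (- u) = {}"
  proof (rule ccontr)
    assume "A u \<inter> A (- u) \<noteq> {}"
    then obtain t where "t \<in> A u" "t \<in> A (- u)" by auto
    moreover from this obtain i where "t = real i" by (auto simp: A_def)
    ultimately show False using alt[of i i] \<delta> by simp
  qed
  \<comment> \<open>The moment lemma works with sets of reals;
    \<open>nat \<lfloor>t\<rfloor>\<close> recovers the index from
    \<open>t = real i\<close>.\<close>
  define q where "q v t = w v (nat \<lfloor>t\<rfloor>) / T v" for v and t :: real
  have q_pos: "0 < q v t" if "t \<in> A v" for v t
    using that T by (auto simp: A_def q_def)
  have moment: "(\<Sum>t\<in>A v. q v t * h t) = (\<Sum>i\<le>n. w v i * h (real i)) / T v" for v h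
  proof -
    have "A v = real ` {i. i \<le> n \<and> 0 < w v i}" by (auto simp: A_def)
    then have "(\<Sum>t\<in>A v. q v t * h t) = (\<Sum>i | i \<le> n \<and> 0 < w v i. w v i / T v * h (real i))"
      by (simp add: sum.reindex q_def)
    also have "\<dots> = (\<Sum>i\<le>n. w v i / T v * h (real i))"
      using w0[of v] by (intro sum.mono_neutral_left) (auto simp: less_le)
    finally show ?thesis by (simp add: sum_divide_distrib)
  qed
  have "(\<Sum>t\<in>A v. q v t) = 1" for v
    using moment[of v "\<lambda>_. 1"] \<open>\<And>u. T u \<noteq> 0\<close> by (simp add: T_def)
  then have m0: "(\<Sum>t\<in>A u. q u t) = (\<Sum>t\<in>A (- u). q (- u) t)" by simp
  have m1: "(\<Sum>t\<in>A u. q u t * t) = (\<Sum>t\<in>A (- u). q (- u) t * t)"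
    using c(1) unfolding moment c1_def .
  have m2: "(\<Sum>t\<in>A u. q u t * t\<^sup>2) = (\<Sum>t\<in>A (- u). q (- u) t * t\<^sup>2)"
    using c(2) unfolding moment c2_def .
  obtain t0 t1 t2 t3 where t: "t0 < t1" "t1 < t2" "t2 < t3"
    "t0 \<in> A u \<and> t1 \<in> A (- u) \<and> t2 \<in> A u \<and> t3 \<in> A (- u) \<or>
     t0 \<in> A (- u) \<and> t1 \<in> A u \<and> t2 \<in> A (- u) \<and> t3 \<in> A u"
    by (rule alternation_of_equal_moments[OF finA finA neA neA \<open>A u \<inter> A (- u) = {}\<close>
        q_pos[of _ u] q_pos[of _ "- u"] m0 m1 m2])
  have idx: "\<exists>i\<le>n. t = real i" if "t \<in> A u \<or> t \<in> A (- u)" for t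
    using that by (auto simp: A_def)
  obtain i0 i1 i2 i3 where i: "t0 = real i0" "t1 = real i1" "t2 = real i2" "t3 = real i3" "i3 \<le> n"
    using t(4) idx by metis
  show thesis
  proof (rule that[OF u(1), of i0 i1 i2 i3])
    show "i0 < i1" "i1 < i2" "i2 < i3" "i3 \<le> n" using t i by auto
    \<comment> \<open>After three changes of class \<open>i0\<close> and \<open>i3\<close> lie in
      opposite classes as well. This gives the fourth bound, which serves closed polygons.\<close>
    show "\<delta> \<le> \<bar>u \<bullet> p i1 - u \<bullet> p i0\<bar>" "\<delta> \<le> \<bar>u \<bullet> p i2 - u \<bullet> p i1\<bar>"
      "\<delta> \<le> \<bar>u \<bullet> p i3 - u \<bullet> p i2\<bar>" "\<delta> \<le> \<bar>u \<bullet> p i0 - u \<bullet> p i3\<bar>"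
      using t(4) alt unfolding i by (smt (verit))+
  qed
qed

section \<open>Variation of sequences and the weighted Crofton bound in the plane\<close>

lemma abs_diff_le_variation:
  fixes h :: "nat \<Rightarrow> real"
  assumes "i \<le> j"
  shows "\<bar>h j - h i\<bar> \<le> (\<Sum>k=i..<j. \<bar>h (Suc k) - h k\<bar>)"
  using sum_Suc_diff'[OF assms, of h] sum_abs[of "\<lambda>k. h (Suc k) - h k" "{i..<j}"] by simp

text \<open>A jump from \<open>h n\<close> back to \<open>h 0\<close> closes the path to a loop
  through \<open>h i\<close> and \<open>h j\<close>, which covers the gap between them at least
  twice.\<close>

lemma variation_ge_twice_range:
  fixes h :: "nat \<Rightarrow> real"
  assumes "i \<le> n" "j \<le> n"
  shows "2 * (h i - h j) - \<bar>h n - h 0\<bar> \<le> (\<Sum>k<n. \<bar>h (Suc k) - h k\<bar>)"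
proof -
  have aux: "\<bar>h i - h 0\<bar> + \<bar>h j - h i\<bar> + \<bar>h n - h j\<bar> \<le> (\<Sum>k<n. \<bar>h (Suc k) - h k\<bar>)"
    if "i \<le> j" "j \<le> n" for i j
  proof -
    have "(\<Sum>k<n. \<bar>h (Suc k) - h k\<bar>) = (\<Sum>k=0..<i. \<bar>h (Suc k) - h k\<bar>)
        + (\<Sum>k=i..<j. \<bar>h (Suc k) - h k\<bar>) + (\<Sum>k=j..<n. \<bar>h (Suc k) - h k\<bar>)"
      using that by (simp add: sum.atLeastLessThan_concat lessThan_atLeast0)
    then show ?thesis
      using abs_diff_le_variation[of 0 i h] abs_diff_le_variation[of i j h]
        abs_diff_le_variation[of j n h] that by simp
  qed
  show ?thesis
  proof (cases "i \<le> j")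
    case True
    show ?thesis using aux[OF True assms(2)] by (simp add: abs_if split: if_splits)
  next
    case False
    then have "j \<le> i" by simp
    show ?thesis using aux[OF \<open>j \<le> i\<close> assms(1)] by (simp add: abs_if split: if_splits)
  qed
qed

text \<open>For \<open>(x, y) = (r * cos \<phi>, r * sin \<phi>)\<close> the larger term changes
  from \<open>y * cos s\<close> to \<open>x * sin s\<close> at \<open>s = \<phi>\<close>. With
  \<open>m\<close> the point of \<open>{c..d}\<close> nearest to \<open>\<phi>\<close>, the boundary
  terms and the integral add up to \<open>r * cos (m - \<phi>)\<close>.\<close>

lemma max_sin_cos_has_integral:
  fixes x y c d :: real
  assumes "0 \<le> x" "0 \<le> y" "0 \<le> c" "c \<le> d" "d \<le> pi / 2"
  obtains I where "((\<lambda>s. max (x * sin s) (y * cos s)) has_integral I) {c..d}"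
    "y * sin c + x * cos d + I \<le> sqrt (x\<^sup>2 + y\<^sup>2)"
proof -
  define r where "r = sqrt (x\<^sup>2 + y\<^sup>2)"
  have "\<exists>\<phi>\<ge>0. \<phi> \<le> pi / 2 \<and> x = r * cos \<phi> \<and> y = r * sin \<phi>"
  proof (cases "r = 0")
    case True
    then have "x = 0" "y = 0" by (auto simp: r_def)
    then show ?thesis using True by (intro exI[of _ 0]) auto
  next
    case False
    have r2: "r\<^sup>2 = x\<^sup>2 + y\<^sup>2" by (simp add: r_def)
    have "0 < r" using False by (simp add: r_def less_le)
    have "(x / r)\<^sup>2 + (y / r)\<^sup>2 = 1"
      using False by (simp add: power_divide add_divide_distrib[symmetric] r2[symmetric])
    moreover have "0 \<le> x / r" "0 \<le> y / r" using assms \<open>0 < r\<close> by auto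
    ultimately obtain \<phi> where "0 \<le> \<phi>" "\<phi> \<le> pi / 2" "x / r = cos \<phi>" "y / r = sin \<phi>"
      using sincos_total_pi_half by metis
    then show ?thesis using False by (intro exI[of _ \<phi>]) (auto simp: field_simps)
  qed
  then obtain \<phi> where \<phi>: "0 \<le> \<phi>" "\<phi> \<le> pi / 2" "x = r * cos \<phi>" "y = r * sin \<phi>" by auto
  have "0 \<le> r" by (simp add: r_def)
  define m where "m = max c (min d \<phi>)"
  have m: "c \<le> m" "m \<le> d" using assms by (auto simp: m_def)
  have diff: "x * sin s - y * cos s = r * sin (s - \<phi>)" for s
    by (simp add: \<phi> sin_diff algebra_simps)
  \<comment> \<open>If \<open>\<phi> < c\<close>, then \<open>m = c\<close> and the interval is a
    single point where the other term may be larger; exempting \<open>c\<close> covers this. In the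
    second integral \<open>d\<close> is exempted likewise.\<close>
  have 1: "((\<lambda>s. max (x * sin s) (y * cos s)) has_integral (y * sin m - y * sin c)) {c..m}"
  proof (rule has_integral_eq_rhs[OF has_integral_spike_finite[of "{c}"]])
    show "((\<lambda>s. y * cos s) has_integral (y * sin m - y * sin c)) {c..m}"
      by (rule fundamental_theorem_of_calculus[OF m(1)])
        (auto intro!: derivative_eq_intros simp flip: has_real_derivative_iff_has_vector_derivative)
    fix s assume s: "s \<in> {c..m} - {c}"
    then have "s \<le> \<phi>" "s \<ge> 0" using assms by (auto simp: m_def max_def min_def split: if_splits)
    then have "0 \<le> r * sin (\<phi> - s)" using \<phi> \<open>0 \<le> r\<close> pi_ge_zero
      by (intro mult_nonneg_nonneg sin_ge_zero) auto
    then show "max (x * sin s) (y * cos s) = y * cos s"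
      using diff[of s] sin_minus[of "s - \<phi>"] by (simp add: max_def)
  qed auto
  have 2: "((\<lambda>s. max (x * sin s) (y * cos s)) has_integral (x * cos m - x * cos d)) {m..d}"
  proof (rule has_integral_eq_rhs[OF has_integral_spike_finite[of "{d}"]])
    have "((\<lambda>s. x * sin s) has_integral (- x * cos d - - x * cos m)) {m..d}"
      by (rule fundamental_theorem_of_calculus[OF m(2)])
        (auto intro!: derivative_eq_intros simp flip: has_real_derivative_iff_has_vector_derivative)
    then show "((\<lambda>s. x * sin s) has_integral (x * cos m - x * cos d)) {m..d}" by simp
    fix s assume s: "s \<in> {m..d} - {d}"
    then have "\<phi> \<le> s" "s \<le> pi / 2" using assms by (auto simp: m_def max_def min_def split: if_splits)
    then have "0 \<le> r * sin (s - \<phi>)" using \<phi> \<open>0 \<le> r\<close> pi_ge_zero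
      by (intro mult_nonneg_nonneg sin_ge_zero) auto
    then show "max (x * sin s) (y * cos s) = x * sin s"
      using diff[of s] by (simp add: max_def)
  qed auto
  have "y * sin m + x * cos m = r * cos (m - \<phi>)" by (simp add: \<phi> cos_diff algebra_simps)
  also have "\<dots> \<le> r" using \<open>0 \<le> r\<close> by (simp add: mult_left_le)
  finally have "y * sin c + x * cos d + (y * sin m - y * sin c + (x * cos m - x * cos d)) \<le> r" by simp
  then show thesis using that[OF has_integral_combine[OF m 1 2]] by (simp add: r_def)
qed

text \<open>The max term at angle \<open>s\<close>, summed over the edges, is the mean of the
  variations along \<open>(sin s, cos s)\<close> and \<open>(sin s, - cos s)\<close>. Each is at
  least \<open>2 * W - D * sin s\<close>, where \<open>D\<close> is the length of the chord, which
  is parallel to the first axis. The terms with \<open>sin c\<close> and \<open>cos d\<close> are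
  bounded through the vertical variation, at least \<open>2 * W\<close>, and the horizontal one, at
  least \<open>D\<close>.\<close>

lemma planar_polygon_length_ge:
  fixes X Y :: "nat \<Rightarrow> real"
  assumes width: "\<And>a b. a\<^sup>2 + b\<^sup>2 = 1 \<Longrightarrow>
      \<exists>i\<le>n. \<exists>j\<le>n. W \<le> (a * X i + b * Y i) - (a * X j + b * Y j)"
    and chord: "Y n = Y 0"
    and cd: "0 \<le> c" "c \<le> d" "d \<le> pi / 2"
  shows "2 * W * (sin c + d - c) + \<bar>X n - X 0\<bar> * (2 * cos d - cos c)
    \<le> (\<Sum>k<n. sqrt ((X (Suc k) - X k)\<^sup>2 + (Y (Suc k) - Y k)\<^sup>2))"
proof -
  define x y where "x k = \<bar>X (Suc k) - X k\<bar>" and "y k = \<bar>Y (Suc k) - Y k\<bar>" for k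
  define D where "D = \<bar>X n - X 0\<bar>"
  have "\<exists>I. ((\<lambda>s. max (x k * sin s) (y k * cos s)) has_integral I) {c..d} \<and>
    y k * sin c + x k * cos d + I \<le> sqrt ((X (Suc k) - X k)\<^sup>2 + (Y (Suc k) - Y k)\<^sup>2)" for k
    using max_sin_cos_has_integral[of "x k" "y k" c d] cd by (auto simp: x_def y_def)
  then obtain I where I: "\<And>k. ((\<lambda>s. max (x k * sin s) (y k * cos s)) has_integral I k) {c..d}"
    "\<And>k. y k * sin c + x k * cos d + I k \<le> sqrt ((X (Suc k) - X k)\<^sup>2 + (Y (Suc k) - Y k)\<^sup>2)"
    by metis
  have dir: "2 * W - D * \<bar>a\<bar> \<le> (\<Sum>k<n. \<bar>a * (X (Suc k) - X k) + b * (Y (Suc k) - Y k)\<bar>)"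
    if ab: "a\<^sup>2 + b\<^sup>2 = 1" for a b
  proof -
    obtain i j where ij: "i \<le> n" "j \<le> n" "W \<le> (a * X i + b * Y i) - (a * X j + b * Y j)"
      using width[OF ab] by auto
    have "\<bar>(a * X n + b * Y n) - (a * X 0 + b * Y 0)\<bar> = D * \<bar>a\<bar>"
      by (simp add: D_def chord abs_mult right_diff_distrib[symmetric])
    then show ?thesis
      using variation_ge_twice_range[OF ij(1,2), of "\<lambda>k. a * X k + b * Y k"] ij(3)
      by (simp add: algebra_simps)
  qed
  have pointwise: "2 * W - D * sin s \<le> (\<Sum>k<n. max (x k * sin s) (y k * cos s))"
    if s: "s \<in> {c..d}" for s
  proof -
    have sc: "0 \<le> sin s" "0 \<le> cos s" using s cd pi_ge_zero by (auto intro!: sin_ge_zero cos_ge_zero)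
    have max_eq: "\<bar>sin s * u + cos s * v\<bar> + \<bar>sin s * u + - cos s * v\<bar>
        = 2 * max (\<bar>u\<bar> * sin s) (\<bar>v\<bar> * cos s)" for u v
    proof -
      have "\<bar>P + Q\<bar> + \<bar>P - Q\<bar> = 2 * max \<bar>P\<bar> \<bar>Q\<bar>" for P Q :: real
        by (auto simp: abs_if max_def)
      from this[of "sin s * u" "cos s * v"] show ?thesis
        using sc by (simp add: abs_mult mult.commute)
    qed
    have "2 * (2 * W - D * sin s) \<le>
      (\<Sum>k<n. \<bar>sin s * (X (Suc k) - X k) + cos s * (Y (Suc k) - Y k)\<bar>
          + \<bar>sin s * (X (Suc k) - X k) + - cos s * (Y (Suc k) - Y k)\<bar>)"
      using dir[of "sin s" "cos s"] dir[of "sin s" "- cos s"] sc unfolding sum.distrib by simp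
    also have "\<dots> = 2 * (\<Sum>k<n. max (x k * sin s) (y k * cos s))"
      unfolding max_eq by (simp add: sum_distrib_left x_def y_def)
    finally show ?thesis by simp
  qed
  have "((\<lambda>s. 2 * W - D * sin s) has_integral
      ((2 * W * d + D * cos d) - (2 * W * c + D * cos c))) {c..d}"
    by (rule fundamental_theorem_of_calculus[OF cd(2)])
      (auto intro!: derivative_eq_intros simp flip: has_real_derivative_iff_has_vector_derivative)
  moreover have "((\<lambda>s. \<Sum>k<n. max (x k * sin s) (y k * cos s)) has_integral (\<Sum>k<n. I k)) {c..d}"
    by (intro has_integral_sum I) simp
  \<comment> \<open>The integral contributes \<open>D * (cos d - cos c)\<close>; the further
    \<open>D * cos d\<close> in the claim comes from \<open>hor\<close>.\<close>
  ultimately have int: "(2 * W * d + D * cos d) - (2 * W * c + D * cos c) \<le> (\<Sum>k<n. I k)"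
    using pointwise by (rule has_integral_le)
  have trig: "0 \<le> sin c" "0 \<le> cos d" using cd pi_ge_zero by (auto intro!: sin_ge_zero cos_ge_zero)
  have "2 * W \<le> (\<Sum>k<n. y k)" using dir[of 0 1] by (simp add: y_def)
  then have vert: "2 * W * sin c \<le> (\<Sum>k<n. y k) * sin c" using trig by (intro mult_right_mono)
  have "D \<le> (\<Sum>k<n. x k)"
    using abs_diff_le_variation[of 0 n X] by (simp add: x_def D_def lessThan_atLeast0)
  then have hor: "D * cos d \<le> (\<Sum>k<n. x k) * cos d" using trig by (intro mult_right_mono)
  have "2 * W * (sin c + d - c) + D * (2 * cos d - cos c)
      \<le> (\<Sum>k<n. y k) * sin c + (\<Sum>k<n. x k) * cos d + (\<Sum>k<n. I k)"
    using int vert hor by (simp add: algebra_simps)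
  also have "\<dots> = (\<Sum>k<n. y k * sin c + x k * cos d + I k)"
    by (simp add: sum.distrib sum_distrib_right)
  also have "\<dots> \<le> (\<Sum>k<n. sqrt ((X (Suc k) - X k)\<^sup>2 + (Y (Suc k) - Y k)\<^sup>2))"
    by (intro sum_mono I)
  finally show ?thesis by (simp add: D_def)
qed

section \<open>Orthonormal frames and the length of space polygons\<close>

lemma Bessel_3:
  fixes u e f v :: "'a::real_inner"
  assumes "norm u = 1" "norm e = 1" "norm f = 1" "u \<bullet> e = 0" "u \<bullet> f = 0" "e \<bullet> f = 0"
  shows "(u \<bullet> v)\<^sup>2 + (e \<bullet> v)\<^sup>2 + (f \<bullet> v)\<^sup>2 \<le> (norm v)\<^sup>2"
proof -
  define w where "w = v - ((u \<bullet> v) *\<^sub>R u + (e \<bullet> v) *\<^sub>R e + (f \<bullet> v) *\<^sub>R f)"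
  have one: "u \<bullet> u = 1" "e \<bullet> e = 1" "f \<bullet> f = 1"
    using assms by (simp_all add: dot_square_norm)
  have "0 \<le> w \<bullet> w" by simp
  also have "w \<bullet> w = v \<bullet> v - ((u \<bullet> v)\<^sup>2 + (e \<bullet> v)\<^sup>2 + (f \<bullet> v)\<^sup>2)"
    using assms(4-6) one
    by (simp add: w_def inner_simps inner_commute power2_eq_square algebra_simps)
  finally show ?thesis by (simp add: dot_square_norm)
qed

text \<open>With \<open>D\<close> the chord of the polygon, \<open>f \<bullet> D = 0\<close> puts
  the projected chord parallel to \<open>e\<close>, as the planar bound requires. Two vectors never
  span three-space, so \<open>f\<close> exists even if \<open>D\<close> is zero or parallel to
  \<open>u\<close>.\<close>

lemma orthonormal_frame_exists:
  fixes u D :: "real^3"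
  assumes "norm u = 1"
  obtains e f :: "real^3" where "norm e = 1" "norm f = 1" "u \<bullet> e = 0" "u \<bullet> f = 0" "e \<bullet> f = 0" "f \<bullet> D = 0"
proof -
  have "dim {u, D} \<le> card {u, D}" by (rule dim_le_card) (auto intro: span_base)
  also have "\<dots> \<le> 2" by (simp add: card_insert_if)
  finally have "dim {u, D} < DIM(real^3)" by simp
  then obtain g where g: "g \<noteq> 0" "\<And>y. y \<in> span {u, D} \<Longrightarrow> orthogonal g y"
    by (rule orthogonal_to_subspace_exists) auto
  define f where "f = g /\<^sub>R norm g"
  have f: "norm f = 1" "u \<bullet> f = 0" "f \<bullet> D = 0"
    using g(1) g(2)[of u] g(2)[of D]
    by (auto simp: f_def orthogonal_def span_base inner_commute)
  define e where "e = cross3 u f"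
  have "(norm e)\<^sup>2 = 1" using norm_cross_dot[of u f] f assms by (simp add: e_def)
  then have "norm e = 1" by (simp add: power2_eq_1_iff) (metis norm_ge_zero not_one_le_zero neg_0_le_iff_le order_refl)
  moreover have "u \<bullet> e = 0" "e \<bullet> f = 0" by (simp_all add: e_def dot_cross_self)
  ultimately show thesis using that f by blast
qed

text \<open>The triangle inequality for the vectors \<open>(x i, y i)\<close>; it combines the
  variation along \<open>u\<close> with the planar length.\<close>

lemma sqrt_sum_squares_le:
  fixes x y :: "'i \<Rightarrow> real"
  shows "sqrt ((\<Sum>i\<in>A. x i)\<^sup>2 + (\<Sum>i\<in>A. y i)\<^sup>2) \<le> (\<Sum>i\<in>A. sqrt ((x i)\<^sup>2 + (y i)\<^sup>2))"
proof -
  have "norm (\<Sum>i\<in>A. (x i, y i)) \<le> (\<Sum>i\<in>A. norm (x i, y i))" by (rule norm_sum)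
  then show ?thesis by (simp add: norm_Pair sum_prod)
qed

text \<open>\<open>m\<close> is the number of guaranteed traversals along \<open>u\<close>, and
  \<open>2 * (sin c + d - c)\<close> is the factor from the planar bound. The last condition on
  \<open>c\<close> and \<open>d\<close> keeps the chord term nonnegative.\<close>

lemma polygon_length_ge:
  fixes p :: "nat \<Rightarrow> real^3"
  assumes width: "\<And>u. norm u = 1 \<Longrightarrow> \<exists>i\<le>n. \<exists>j\<le>n. W \<le> u \<bullet> p i - u \<bullet> p j"
    and W: "0 < W"
    and cd: "0 \<le> c" "c \<le> d" "d \<le> pi / 2" "p n = p 0 \<or> cos c \<le> 2 * cos d"
    and m: "m = (if p n = p 0 then 4 else 3)"
  shows "sqrt (m\<^sup>2 + (2 * (sin c + d - c))\<^sup>2) * W \<le> (\<Sum>k<n. norm (p (Suc k) - p k))"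
proof -
  define K where "K = sqrt (m\<^sup>2 + (2 * (sin c + d - c))\<^sup>2)"
  define L where "L = (\<Sum>k<n. norm (p (Suc k) - p k))"
  have "0 < K" by (auto simp: K_def m intro!: add_pos_nonneg)
  have "0 \<le> sin c" using cd pi_ge_zero by (auto intro!: sin_ge_zero)
  then have S: "0 \<le> 2 * (sin c + d - c)" using cd by simp
  \<comment> \<open>The alternation is available only for gaps below \<open>W\<close>; letting
    \<open>\<delta>\<close> tend to \<open>W\<close> finishes the proof.\<close>
  have "\<delta> \<le> L / K" if \<delta>: "0 < \<delta>" "\<delta> < W" for \<delta>
  proof -
    obtain u i0 i1 i2 i3 where u: "norm u = 1" and i: "i0 < i1" "i1 < i2" "i2 < i3" "i3 \<le> n" and
      alt: "\<delta> \<le> \<bar>u \<bullet> p i1 - u \<bullet> p i0\<bar>" "\<delta> \<le> \<bar>u \<bullet> p i2 - u \<bullet> p i1\<bar>"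
      "\<delta> \<le> \<bar>u \<bullet> p i3 - u \<bullet> p i2\<bar>" "\<delta> \<le> \<bar>u \<bullet> p i0 - u \<bullet> p i3\<bar>"
      using Wienholtz_alternation[OF width \<delta>] by metis
    define h where "h k = u \<bullet> p k" for k
    define x where "x k = \<bar>h (Suc k) - h k\<bar>" for k
    have "(\<Sum>k<n. x k) = (\<Sum>k=0..<i0. x k) + (\<Sum>k=i0..<i1. x k) + (\<Sum>k=i1..<i2. x k)
        + (\<Sum>k=i2..<i3. x k) + (\<Sum>k=i3..<n. x k)"
      using i by (simp add: sum.atLeastLessThan_concat lessThan_atLeast0)
    then have var: "\<bar>h i0 - h 0\<bar> + \<bar>h i1 - h i0\<bar> + \<bar>h i2 - h i1\<bar> + \<bar>h i3 - h i2\<bar> + \<bar>h n - h i3\<bar>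
        \<le> (\<Sum>k<n. x k)"
      using abs_diff_le_variation[of 0 i0 h] abs_diff_le_variation[of i0 i1 h]
        abs_diff_le_variation[of i1 i2 h] abs_diff_le_variation[of i2 i3 h]
        abs_diff_le_variation[of i3 n h] i unfolding x_def by simp
    have V: "m * \<delta> \<le> (\<Sum>k<n. x k)"
    \<comment> \<open>In a closed polygon the stretches before \<open>i0\<close> and after
      \<open>i3\<close> join to a fourth traversal.\<close>
    proof (cases "p n = p 0")
      case True
      then have "h n = h 0" by (simp add: h_def)
      then have "\<bar>h i0 - h i3\<bar> \<le> \<bar>h i0 - h 0\<bar> + \<bar>h n - h i3\<bar>" by simp
      then show ?thesis using var alt True by (simp add: m h_def)
    next
      case False
      then show ?thesis using var alt by (simp add: m h_def)
    qed
    obtain e f where ef: "norm e = 1" "norm f = 1" "u \<bullet> e = 0" "u \<bullet> f = 0" "e \<bullet> f = 0"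
      "f \<bullet> (p n - p 0) = 0"
      using orthonormal_frame_exists[OF u] by metis
    define X Y where "X k = e \<bullet> p k" and "Y k = f \<bullet> p k" for k
    define y where "y k = sqrt ((X (Suc k) - X k)\<^sup>2 + (Y (Suc k) - Y k)\<^sup>2)" for k
    \<comment> \<open>A unit vector of the plane spanned by \<open>e\<close> and \<open>f\<close> is
      a unit vector of space, so the projection inherits the width bound.\<close>
    have "\<exists>i\<le>n. \<exists>j\<le>n. W \<le> (a * X i + b * Y i) - (a * X j + b * Y j)" if "a\<^sup>2 + b\<^sup>2 = 1" for a b
    proof -
      have "e \<bullet> e = 1" "f \<bullet> f = 1" using ef by (simp_all add: dot_square_norm)
      then have "(a *\<^sub>R e + b *\<^sub>R f) \<bullet> (a *\<^sub>R e + b *\<^sub>R f) = a\<^sup>2 + b\<^sup>2"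
        using ef(5) by (simp add: inner_simps inner_commute[of f e] power2_eq_square)
      then have "norm (a *\<^sub>R e + b *\<^sub>R f) = 1" using that by (simp add: norm_eq_sqrt_inner)
      from width[OF this] show ?thesis by (simp add: X_def Y_def inner_simps)
    qed
    moreover have "Y n = Y 0" using ef(6) by (simp add: Y_def inner_simps)
    ultimately have "2 * W * (sin c + d - c) + \<bar>X n - X 0\<bar> * (2 * cos d - cos c) \<le> (\<Sum>k<n. y k)"
      unfolding y_def using cd(1-3) by (rule planar_polygon_length_ge)
    moreover have "0 \<le> \<bar>X n - X 0\<bar> * (2 * cos d - cos c)"
      using cd(4) by (auto simp: X_def)
    moreover have "\<delta> * (2 * (sin c + d - c)) \<le> W * (2 * (sin c + d - c))"
      using \<delta> S by (intro mult_right_mono) auto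
    ultimately have P: "\<delta> * (2 * (sin c + d - c)) \<le> (\<Sum>k<n. y k)" by (simp add: algebra_simps)
    have "\<delta> * K = sqrt ((m * \<delta>)\<^sup>2 + (\<delta> * (2 * (sin c + d - c)))\<^sup>2)"
    proof -
      have "(m * \<delta>)\<^sup>2 + (\<delta> * (2 * (sin c + d - c)))\<^sup>2 = \<delta>\<^sup>2 * (m\<^sup>2 + (2 * (sin c + d - c))\<^sup>2)"
        by (simp only: power_mult_distrib) (simp add: algebra_simps)
      then show ?thesis using \<delta> by (simp add: K_def real_sqrt_mult)
    qed
    also have "\<dots> \<le> sqrt ((\<Sum>k<n. x k)\<^sup>2 + (\<Sum>k<n. y k)\<^sup>2)"
      using V P S \<delta> by (intro real_sqrt_le_mono add_mono power_mono mult_nonneg_nonneg) (auto simp: m)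
    also have "\<dots> \<le> (\<Sum>k<n. sqrt ((x k)\<^sup>2 + (y k)\<^sup>2))" by (rule sqrt_sum_squares_le)
    also have "\<dots> \<le> L"
      unfolding L_def
    proof (rule sum_mono)
      fix k
      have "(x k)\<^sup>2 + (y k)\<^sup>2 \<le> (norm (p (Suc k) - p k))\<^sup>2"
        using Bessel_3[OF u ef(1-5), of "p (Suc k) - p k"]
        by (simp add: x_def y_def h_def X_def Y_def inner_simps)
      then show "sqrt ((x k)\<^sup>2 + (y k)\<^sup>2) \<le> norm (p (Suc k) - p k)"
        by (rule real_le_lsqrt[rotated]) simp
    qed
    finally show ?thesis using \<open>0 < K\<close> by (simp add: field_simps)
  qed
  then have "W \<le> L / K" using dense_le_bounded[OF W] by blast
  then show ?thesis using \<open>0 < K\<close> by (simp add: field_simps K_def L_def)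
qed

section \<open>From curves to inscribed polygons\<close>

lemma poly_length_le_curve_length:
  assumes "rectifiable_curve \<gamma> a b" "is_partition a b ts"
  shows "poly_length \<gamma> ts \<le> real_of_ereal (curve_length \<gamma> a b)"
proof -
  have le: "ereal (poly_length \<gamma> ts) \<le> curve_length \<gamma> a b"
    unfolding curve_length_def using assms(2) by (intro SUP_upper) auto
  moreover have "curve_length \<gamma> a b < \<infinity>" using assms(1) by (simp add: rectifiable_curve_def)
  ultimately show ?thesis by (cases "curve_length \<gamma> a b") auto
qed

lemma curve_length_nonneg:
  assumes "a \<le> b" "rectifiable_curve \<gamma> a b"
  shows "0 \<le> real_of_ereal (curve_length \<gamma> a b)"
proof -
  have "is_partition a b [a, b]" using assms by (simp add: is_partition_def)
  from poly_length_le_curve_length[OF assms(2) this]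
  show ?thesis by (rule order_trans[rotated]) (simp add: poly_length_def)
qed

text \<open>The height along \<open>u\<close> attains its extremes by compactness, and the slab
  between them competes in the infimum.\<close>

lemma curve_width_le_range:
  fixes u :: "real^3"
  assumes "a \<le> b" "continuous_on {a..b} \<gamma>" "norm u = 1"
  obtains s t where "s \<in> {a..b}" "t \<in> {a..b}" "curve_width \<gamma> a b \<le> u \<bullet> \<gamma> s - u \<bullet> \<gamma> t"
proof -
  have c: "continuous_on {a..b} (\<lambda>t. u \<bullet> \<gamma> t)" by (intro continuous_intros assms)
  have ne: "{a..b} \<noteq> {}" using assms by simp
  obtain s where s: "s \<in> {a..b}" "\<forall>t\<in>{a..b}. u \<bullet> \<gamma> t \<le> u \<bullet> \<gamma> s"
    using continuous_attains_sup[OF compact_Icc ne c] by auto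
  obtain t where t: "t \<in> {a..b}" "\<forall>s\<in>{a..b}. u \<bullet> \<gamma> t \<le> u \<bullet> \<gamma> s"
    using continuous_attains_inf[OF compact_Icc ne c] by auto
  have "curve_width \<gamma> a b \<le> u \<bullet> \<gamma> s - u \<bullet> \<gamma> t"
    unfolding curve_width_def
  proof (rule cInf_lower)
    show "bdd_below {d - c |u c d. norm u = 1 \<and> c \<le> d \<and>
        (\<forall>t\<in>{a..b}. c \<le> u \<bullet> \<gamma> t \<and> u \<bullet> \<gamma> t \<le> d)}"
      by (rule bdd_belowI[of _ 0]) auto
  qed (use s t assms(3) in blast)
  then show thesis using that s t by blast
qed

text \<open>By uniform continuity the vertices of a fine equidistant subdivision come within
  \<open>\<eta>\<close> of every point of the curve. In each direction the extent thus drops by less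
  than \<open>2 * \<eta>\<close>, whatever the direction.\<close>

lemma inscribed_polygon_exists:
  fixes \<gamma> :: "real \<Rightarrow> real^3"
  assumes ab: "a \<le> b" and cont: "continuous_on {a..b} \<gamma>" and rect: "rectifiable_curve \<gamma> a b"
    and W: "W < curve_width \<gamma> a b"
  obtains p n where "p 0 = \<gamma> a" "p n = \<gamma> b"
    "(\<Sum>k<n. norm (p (Suc k) - p k)) \<le> real_of_ereal (curve_length \<gamma> a b)"
    "\<And>u. norm u = 1 \<Longrightarrow> \<exists>i\<le>n. \<exists>j\<le>n. W \<le> u \<bullet> p i - u \<bullet> p j"
proof -
  define \<eta> where "\<eta> = (curve_width \<gamma> a b - W) / 2"
  have "0 < \<eta>" using W by (simp add: \<eta>_def)
  moreover have "uniformly_continuous_on {a..b} \<gamma>"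
    using cont by (intro compact_uniformly_continuous) auto
  ultimately obtain \<rho> where \<rho>: "0 < \<rho>"
    "\<And>s t. s \<in> {a..b} \<Longrightarrow> t \<in> {a..b} \<Longrightarrow> dist t s < \<rho> \<Longrightarrow> dist (\<gamma> t) (\<gamma> s) < \<eta>"
    unfolding uniformly_continuous_on_def by metis
  \<comment> \<open>The strict bound makes the mesh \<open>h\<close> smaller than
    \<open>\<rho>\<close> and gives \<open>0 < n\<close> even when \<open>a = b\<close>.\<close>
  obtain n where n: "(b - a) / \<rho> < real n" using reals_Archimedean2 by blast
  moreover have "0 \<le> (b - a) / \<rho>" using ab \<rho> by simp
  ultimately have n0: "0 < real n" by linarith
  define h where "h = (b - a) / real n"
  have h: "0 \<le> h" "h < \<rho>" "real n * h = b - a"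
    using n n0 ab \<rho> by (auto simp: h_def field_simps)
  define g where "g i = a + real i * h" for i
  define p where "p i = \<gamma> (g i)" for i
  have g_in: "g i \<in> {a..b}" if "i \<le> n" for i
    using mult_right_mono[of "real i" "real n" h] that h by (auto simp: g_def)
  have near: "\<exists>i\<le>n. dist (p i) (\<gamma> t) < \<eta>" if t: "t \<in> {a..b}" for t
  proof -
    have "\<exists>i\<le>n. \<bar>g i - t\<bar> < \<rho>"
    proof (cases "h = 0")
      case True
      then show ?thesis using t h \<rho> by (intro exI[of _ 0]) (auto simp: g_def)
    next
      case False
      then have "0 < h" using h by simp
      define i where "i = nat \<lfloor>(t - a) / h\<rfloor>"
      have "0 \<le> (t - a) / h" using t \<open>0 < h\<close> by simp
      then have i: "real i \<le> (t - a) / h" "(t - a) / h < real i + 1" unfolding i_def by linarith+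
      have "real i * h \<le> t - a" "t - a < real i * h + h"
        using i \<open>0 < h\<close> by (simp_all add: field_simps)
      moreover have "(t - a) / h \<le> real n" using t h \<open>0 < h\<close> by (simp add: field_simps)
      ultimately show ?thesis using i h by (intro exI[of _ i]) (auto simp: g_def)
    qed
    then show ?thesis using \<rho>(2)[OF t] g_in by (metis dist_real_def p_def)
  qed
  define ts where "ts = map g [0..<Suc n]"
  have "is_partition a b ts"
    unfolding is_partition_def
  proof (intro conjI)
    show "ts \<noteq> []" by (simp add: ts_def)
    show "hd ts = a" by (simp add: ts_def g_def hd_map del: upt_Suc)
    show "last ts = b" using h by (simp add: ts_def g_def)
    show "sorted ts"
      unfolding ts_def using h(1)
      by (auto simp: sorted_map g_def intro!: mult_right_mono sorted_wrt_mono_rel[OF _ sorted_upt] simp del: upt_Suc)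
  qed
  then have "poly_length \<gamma> ts \<le> real_of_ereal (curve_length \<gamma> a b)"
    by (rule poly_length_le_curve_length[OF rect])
  moreover have "poly_length \<gamma> ts = (\<Sum>k<n. norm (p (Suc k) - p k))"
    unfolding poly_length_def by (intro sum.cong) (auto simp: ts_def p_def simp del: upt_Suc)
  ultimately have len: "(\<Sum>k<n. norm (p (Suc k) - p k)) \<le> real_of_ereal (curve_length \<gamma> a b)" by simp
  have "\<exists>i\<le>n. \<exists>j\<le>n. W \<le> u \<bullet> p i - u \<bullet> p j" if u: "norm u = 1" for u
  proof -
    obtain s t where st: "s \<in> {a..b}" "t \<in> {a..b}" "curve_width \<gamma> a b \<le> u \<bullet> \<gamma> s - u \<bullet> \<gamma> t"
      by (rule curve_width_le_range[OF ab cont u])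
    obtain i j where ij: "i \<le> n" "dist (p i) (\<gamma> s) < \<eta>" "j \<le> n" "dist (p j) (\<gamma> t) < \<eta>"
      using near st by metis
    have close: "\<bar>u \<bullet> p k - u \<bullet> \<gamma> r\<bar> < \<eta>" if "dist (p k) (\<gamma> r) < \<eta>" for k r
      using Cauchy_Schwarz_ineq2[of u "p k - \<gamma> r"] that u by (simp add: inner_simps dist_norm)
    have "W \<le> u \<bullet> p i - u \<bullet> p j"
      using close[OF ij(2)] close[OF ij(4)] st(3) by (simp add: \<eta>_def abs_if field_simps split: if_splits)
    then show ?thesis using ij by blast
  qed
  moreover have "p 0 = \<gamma> a" "p n = \<gamma> b" using h by (auto simp: p_def g_def)
  ultimately show thesis using that len by blast
qed

text \<open>Inscribed polygons keep the endpoints, hence the value of \<open>m\<close>, and attain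
  every width bound below that of the curve.\<close>

lemma curve_length_ge:
  fixes \<gamma> :: "real \<Rightarrow> real^3"
  assumes ab: "a \<le> b" and cont: "continuous_on {a..b} \<gamma>" and rect: "rectifiable_curve \<gamma> a b"
    and cd: "0 \<le> c" "c \<le> d" "d \<le> pi / 2" "\<gamma> b = \<gamma> a \<or> cos c \<le> 2 * cos d"
    and m: "m = (if \<gamma> b = \<gamma> a then 4 else 3)"
  shows "sqrt (m\<^sup>2 + (2 * (sin c + d - c))\<^sup>2) * curve_width \<gamma> a b \<le> real_of_ereal (curve_length \<gamma> a b)"
proof -
  define K where "K = sqrt (m\<^sup>2 + (2 * (sin c + d - c))\<^sup>2)"
  define L where "L = real_of_ereal (curve_length \<gamma> a b)"
  have "0 < K" by (auto simp: K_def m intro!: add_pos_nonneg)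
  show ?thesis
  proof (cases "0 < curve_width \<gamma> a b")
    case True
    have "W \<le> L / K" if W: "0 < W" "W < curve_width \<gamma> a b" for W
    proof (rule inscribed_polygon_exists[OF ab cont rect W(2)], fold L_def)
      fix p :: "nat \<Rightarrow> real^3" and n
      assume p: "p 0 = \<gamma> a" "p n = \<gamma> b" "(\<Sum>k<n. norm (p (Suc k) - p k)) \<le> L"
        "\<And>u. norm u = 1 \<Longrightarrow> \<exists>i\<le>n. \<exists>j\<le>n. W \<le> u \<bullet> p i - u \<bullet> p j"
      have "K * W \<le> (\<Sum>k<n. norm (p (Suc k) - p k))"
        unfolding K_def
        by (rule polygon_length_ge[OF p(4) W(1) cd(1-3)]) (use cd(4) m in \<open>simp_all add: p(1,2)\<close>)
      then show "W \<le> L / K" using p(3) \<open>0 < K\<close> by (simp add: field_simps)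
    qed
    then have "curve_width \<gamma> a b \<le> L / K" using dense_le_bounded[OF True] by blast
    then show ?thesis using \<open>0 < K\<close> by (simp add: field_simps K_def L_def)
  next
    case False
    then have "K * curve_width \<gamma> a b \<le> 0" using \<open>0 < K\<close> by (simp add: mult_le_0_iff)
    also have "0 \<le> L" unfolding L_def by (rule curve_length_nonneg[OF ab rect])
    finally show ?thesis by (simp add: K_def L_def)
  qed
qed

section \<open>The numerical constant and the conclusion\<close>

text \<open>
  Subject to \<open>2 * cos d = cos c\<close>, the maximum of \<open>sin c + d - c\<close> is attained near
  \<open>cos c = 0.572\<close>; the value at \<open>4/7\<close> differs from it only in the seventh decimal.
\<close>

lemma open_curve_constant:
  "3.7669 \<le> sqrt (3\<^sup>2 + (2 * (sin (arccos (4/7)) + arccos (2/7) - arccos (4/7)))\<^sup>2)"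
proof -
  define c d where "c = arccos (4/7 :: real)" and "d = arccos (2/7 :: real)"
  have cos: "cos c = 4/7" "cos d = 2/7" by (simp_all add: c_def d_def)
  have sin: "sin c = sqrt 33 / 7" "sin d = sqrt 45 / 7"
    by (simp_all add: c_def d_def sin_arccos power2_eq_square real_sqrt_divide)
  have cd: "c \<le> d" "0 \<le> c" "d \<le> pi" by (auto simp: c_def d_def intro!: arccos_le_arccos arccos_lbound arccos_ubound)
  have r: "5.74455 \<le> sqrt 33" "sqrt 33 \<le> 5.74457" "6.7082 \<le> sqrt 45"
    by (rule real_le_rsqrt real_le_lsqrt; simp add: power2_eq_square)+
  have "sin (d - c) = (4 * sqrt 45 - 2 * sqrt 33) / 49"
    by (simp add: sin_diff cos sin field_simps)
  then have "0.3131 \<le> sin (d - c)" using r by simp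
  \<comment> \<open>Comparing sines gives \<open>0.3184 \<le> d - c\<close>; the cubic Taylor
    polynomial with its fifth-order error suffices.\<close>
  moreover have "sin (0.3184::real) < 0.3131"
  proof -
    have "\<bar>sin x - (x - x ^ 3 / 6)\<bar> \<le> inverse (fact 5) * \<bar>x\<bar> ^ 5" for x :: real
      using Maclaurin_sin_bound[of x 5]
      by (simp add: sin_coeff_def lessThan_nat_numeral fact_numeral)
    from this[of "0.3184"] show ?thesis
      by (simp add: fact_numeral abs_if power_divide split: if_splits)
  qed
  ultimately have "\<not> d - c < 0.3184"
    using sin_monotone_2pi[of "d - c" "0.3184"] cd pi_gt3 by force
  \<comment> \<open>\<open>5.74455 / 7 = 0.82065\<close>, and
    \<open>0.82065 + 0.3184 = 1.13905\<close>. The square of \<open>2.2781\<close> plus 9 just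
    exceeds that of \<open>3.7669\<close>.\<close>
  then have "1.13905 \<le> sin c + d - c" using r by (simp add: sin)
  then have "(2 * 1.13905)\<^sup>2 \<le> (2 * (sin c + d - c))\<^sup>2" by (intro power_mono) auto
  then show ?thesis unfolding c_def d_def by (intro real_le_rsqrt) (simp add: power2_eq_square)
qed

theorem theorem1p1:
  fixes \<gamma> :: "real \<Rightarrow> real^3" and a b :: real
  assumes "a \<le> b"
    and "continuous_on {a..b} \<gamma>"
    and "rectifiable_curve \<gamma> a b"
  shows "real_of_ereal (curve_length \<gamma> a b) \<ge> 3.7669 * curve_width \<gamma> a b \<and>
         (\<gamma> a = \<gamma> b \<longrightarrow>
           real_of_ereal (curve_length \<gamma> a b) \<ge> sqrt (pi\<^sup>2 + 16) * curve_width \<gamma> a b)"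
proof -
  define w L where "w = curve_width \<gamma> a b" and "L = real_of_ereal (curve_length \<gamma> a b)"
  define m :: real where "m = (if \<gamma> b = \<gamma> a then 4 else 3)"
  note ge = curve_length_ge[OF assms _ _ _ _ m_def, folded w_def L_def]
  \<comment> \<open>For \<open>c = 0\<close> and \<open>d = pi / 2\<close> the planar factor is
    \<open>pi\<close>.\<close>
  have closed: "sqrt (pi\<^sup>2 + 16) * w \<le> L" if "\<gamma> a = \<gamma> b"
    using ge[of 0 "pi / 2"] that by (simp add: m_def add.commute)
  define S where "S = sin (arccos (4/7)) + arccos (2/7) - arccos (4/7 :: real)"
  \<comment> \<open>The cosines \<open>4/7\<close> and \<open>2/7\<close> satisfy
    \<open>cos c = 2 * cos d\<close>, so this choice is admissible for open and closed curves
    alike.\<close>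
  have "sqrt (m\<^sup>2 + (2 * S)\<^sup>2) * w \<le> L"
    unfolding S_def
  proof (rule ge)
    show "0 \<le> arccos (4/7 :: real)" "arccos (4/7) \<le> arccos (2/7 :: real)"
      by (auto intro!: arccos_lbound arccos_le_arccos)
    show "arccos (2/7) \<le> pi / 2" using arccos_le_pi2[of "2/7"] by simp
  qed simp
  \<comment> \<open>A closed curve has \<open>m = 4\<close>, which only enlarges the
    constant.\<close>
  moreover have "3.7669 \<le> sqrt (m\<^sup>2 + (2 * S)\<^sup>2)"
  proof -
    have "3.7669 \<le> sqrt (3\<^sup>2 + (2 * S)\<^sup>2)" unfolding S_def by (rule open_curve_constant)
    also have "\<dots> \<le> sqrt (m\<^sup>2 + (2 * S)\<^sup>2)" by (simp add: m_def)
    finally show ?thesis .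
  qed
  moreover have "0 \<le> L" unfolding L_def by (rule curve_length_nonneg[OF assms(1,3)])
  ultimately have "3.7669 * w \<le> L"
    by (cases "0 \<le> w") (auto intro: order_trans mult_right_mono)
  then show ?thesis using closed by (simp add: w_def L_def)
qed

end
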